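(* Let $K\subseteq\mathbb{R}^n$ be an open convex set, let $f:K\to\mathbb{R}$ and $g_i:K\to\mathbb{R}$ for $i\in I:=\{1,\dots,m\}$, and let $C:=\{x\in K:\ g_i(x)\le 0\ \ \forall i\in I\}$. For each $i\in I$ let $e_i:\mathbb{R}^n\times\mathbb{R}^n\to\mathbb{R}$ be an error bifunction. Suppose that $C$ is convex, $f$ is pseudoconvex, each $g_i$ is $e_i$-quasiconvex, and $f$ and $g=(g_1,\dots,g_m)$ are differentiable at $\overline{x}\in K$. If there exists $\overline{u}\in\mathbb{R}^m$ such that $$\Big\langle\nabla f(\overline{x})+\sum_{i=1}^m\overline{u}_i\nabla g_i(\overline{x}),\ x-\overline{x}\Big\rangle\ \ge\ \sum_{i=1}^m\overline{u}_i e_i(x,\overline{x})\quad\text{for all } x\in C,$$ $$\sum_{i=1}^m\overline{u}_i g_i(\overline{x})=0,\qquad g_i(\overline{x})\le 0\ \ \text{for all } i\in I,\qquad \overline{u}\ge 0 \ (\text{componentwise}),$$ then $\overline{x}$ is a global minimum of the problem $\min_{x\in C} f(x)$.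
   Context: An error bifunction is a map $e:\mathbb{R}^n\times\mathbb{R}^n\to\mathbb{R}\cup\{+\infty\}$ that is nonnegative, symmetric ($e(x,y)=e(y,x)$) and finite at some point; here the $e_i$ are real-valued. A function $\varphi:K\to\mathbb{R}$ is $e$-quasiconvex (on the convex set $K$) if for all $x,y\in K$ and all $t\in\,]0,1[$, $$\varphi(tx+(1-t)y)\le\max\{\varphi(x),\varphi(y)\}+t(1-t)e(x,y).$$ A differentiable function $f:K\to\mathbb{R}$ is pseudoconvex if for all $x,y\in K$, $$\langle\nabla f(x),y-x\rangle\ge 0\ \Longrightarrow\ f(y)\ge f(x).$$ *)

theory Defs
  imports "HOL-Analysis.Analysis"
begin

text \<open>The gradient with respect to the inner product; only meaningful where \<open>f\<close> is differentiable.\<close>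

definition grad :: "('a::real_inner \<Rightarrow> real) \<Rightarrow> 'a \<Rightarrow> 'a" where
  "grad f x = (THE D. GDERIV f x :> D)"

text \<open>Nonnegativity rules out the value \<open>-\<infinity>\<close>, so \<^typ>\<open>ereal\<close> renders
  \<open>\<real> \<union> {+\<infinity>}\<close>.\<close>

definition error_bifunction :: "('a \<Rightarrow> 'a \<Rightarrow> ereal) \<Rightarrow> bool" where
  "error_bifunction e \<longleftrightarrow>
     (\<forall>x y. 0 \<le> e x y) \<and> (\<forall>x y. e x y = e y x) \<and> (\<exists>x y. e x y \<noteq> \<infinity>)"

definition e_quasiconvex_on ::
    "'a::real_vector set \<Rightarrow> ('a \<Rightarrow> 'a \<Rightarrow> ereal) \<Rightarrow> ('a \<Rightarrow> real) \<Rightarrow> bool" where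
  "e_quasiconvex_on K e \<phi> \<longleftrightarrow>
     (\<forall>x\<in>K. \<forall>y\<in>K. \<forall>t\<in>{0<..<1}.
        ereal (\<phi> (t *\<^sub>R x + (1 - t) *\<^sub>R y))
          \<le> ereal (max (\<phi> x) (\<phi> y)) + ereal (t * (1 - t)) * e x y)"

text \<open>Intended for open \<open>K\<close>: derivatives are taken at \<open>x\<close>, not within \<open>K\<close>.\<close>

definition pseudoconvex_on :: "'a::real_inner set \<Rightarrow> ('a \<Rightarrow> real) \<Rightarrow> bool" where
  "pseudoconvex_on K f \<longleftrightarrow>
     (\<forall>x\<in>K. f differentiable (at x)) \<and>
     (\<forall>x\<in>K. \<forall>y\<in>K. grad f x \<bullet> (y - x) \<ge> 0 \<longrightarrow> f y \<ge> f x)"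

end

theory Submission
  imports Defs
begin

text \<open>If \<open>\<phi>\<close> is \<open>e\<close>-quasiconvex and \<open>\<phi> x \<le> \<phi> a\<close>, the difference quotient of \<open>\<phi>\<close>
  at \<open>a\<close> towards \<open>x\<close> is at most \<open>(1 - t) * e x a\<close>, so letting \<open>t\<close> tend to 0 gives
  \<open>grad \<phi> a \<bullet> (x - a) \<le> e x a\<close>. By complementary slackness this applies to every constraint
  with a nonzero multiplier; subtracting these bounds from the KKT inequality leaves
  \<open>grad f a \<bullet> (x - a) \<ge> 0\<close>, and pseudoconvexity concludes.\<close>

text \<open>Riesz representation: a linear functional \<open>f'\<close> is the inner product with
  \<open>adjoint f' 1\<close>. Since the derivative is unique, so is this vector, and the
  description operator in \<open>grad\<close> is well defined.\<close>

lemma GDERIV_grad: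
  fixes f :: "'a::euclidean_space \<Rightarrow> real"
  assumes "f differentiable (at x)"
  shows "GDERIV f x :> grad f x"
proof -
  obtain f' where f': "(f has_derivative f') (at x)"
    using assms unfolding differentiable_def by blast
  define D where "D = adjoint f' 1"
  have "linear f'"
    using f' has_derivative_linear by blast
  then have "f' = (\<lambda>h. h \<bullet> D)"
    unfolding D_def by (simp add: adjoint_works fun_eq_iff)
  then have D: "GDERIV f x :> D"
    using f' unfolding gderiv_def by simp
  have "D' = D" if "GDERIV f x :> D'" for D'
  proof -
    have "(\<lambda>h. h \<bullet> D') = (\<lambda>h. h \<bullet> D)"
      using that D unfolding gderiv_def by (rule has_derivative_unique)
    then show ?thesis
      by (metis vector_eq_ldot)
  qed
  with D show ?thesis
    unfolding grad_def by (rule theI)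
qed

lemma grad_le_of_e_quasiconvex_on:
  fixes \<phi> :: "'a::euclidean_space \<Rightarrow> real"
  assumes quasi: "e_quasiconvex_on K (\<lambda>x y. ereal (e x y)) \<phi>"
    and K: "x \<in> K" "a \<in> K"
    and diff: "\<phi> differentiable (at a)"
    and le: "\<phi> x \<le> \<phi> a"
  shows "grad \<phi> a \<bullet> (x - a) \<le> e x a"
proof -
  define p where "p t = \<phi> (a + t *\<^sub>R (x - a))" for t
  \<comment> \<open>The base point \<open>a\<close> is written as the value at 0 of the path
    \<open>a + t *\<^sub>R (x - a)\<close>, which is the form the chain rule expects.\<close>
  have "(\<phi> has_derivative (\<lambda>h. h \<bullet> grad \<phi> a)) (at (a + 0 *\<^sub>R (x - a)))"
    using GDERIV_grad[OF diff] by (simp add: gderiv_def)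
  moreover have "((\<lambda>t. a + t *\<^sub>R (x - a)) has_derivative (\<lambda>t. t *\<^sub>R (x - a))) (at 0)"
    by (auto intro!: derivative_eq_intros)
  ultimately have "(p has_derivative (\<lambda>t. t *\<^sub>R (x - a) \<bullet> grad \<phi> a)) (at 0)"
    using has_derivative_compose unfolding p_def by blast
  then have "(p has_field_derivative grad \<phi> a \<bullet> (x - a)) (at 0)"
    by (simp add: has_field_derivative_def inner_commute mult.commute[of _ "inner _ _"])
  \<comment> \<open>Only the one-sided limit is taken, because quasiconvexity bounds the quotient
    only for \<open>t\<close> between 0 and 1.\<close>
  then have "((\<lambda>t. (p t - p 0) / t) \<longlongrightarrow> grad \<phi> a \<bullet> (x - a)) (at_right 0)"
    by (auto simp: has_field_derivative_iff intro: tendsto_within_subset)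
  moreover have "((\<lambda>t. (1 - t) * e x a) \<longlongrightarrow> e x a) (at_right 0)"
    by (auto intro!: tendsto_eq_intros)
  moreover have "(p t - p 0) / t \<le> (1 - t) * e x a" if t: "t \<in> {0<..<1}" for t
  proof -
    have "ereal (\<phi> (t *\<^sub>R x + (1 - t) *\<^sub>R a))
        \<le> ereal (max (\<phi> x) (\<phi> a)) + ereal (t * (1 - t)) * ereal (e x a)"
      using quasi K t unfolding e_quasiconvex_on_def by blast
    moreover have "t *\<^sub>R x + (1 - t) *\<^sub>R a = a + t *\<^sub>R (x - a)"
      by (simp add: algebra_simps)
    \<comment> \<open>By \<open>le\<close>, the maximum is attained at \<open>a\<close>, that is, it
      equals \<open>p 0\<close>.\<close>
    ultimately have "p t \<le> p 0 + t * (1 - t) * e x a"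
      using le by (simp add: p_def max_absorb2)
    then show ?thesis
      using t by (simp add: field_simps)
  qed
  then have "\<forall>\<^sub>F t in at_right 0. (p t - p 0) / t \<le> (1 - t) * e x a"
    by (auto simp: eventually_at_right_field intro!: exI[of _ 1])
  ultimately show ?thesis
    by (intro tendsto_le) auto
qed

theorem theorem19:
  fixes K C :: "(real ^ 'n) set"
    and f :: "real ^ 'n \<Rightarrow> real"
    and g :: "real ^ 'n \<Rightarrow> real ^ 'm"
    and e :: "'m \<Rightarrow> real ^ 'n \<Rightarrow> real ^ 'n \<Rightarrow> real"
    and xbar :: "real ^ 'n"
  assumes "open K" and "convex K"
    and C_eq: "C = {x \<in> K. \<forall>i. g x $ i \<le> 0}"
    and "\<And>i. error_bifunction (\<lambda>x y. ereal (e i x y))"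
    and "convex C"
    and "pseudoconvex_on K f"
    and "\<And>i. e_quasiconvex_on K (\<lambda>x y. ereal (e i x y)) (\<lambda>x. g x $ i)"
    and "xbar \<in> K"
    and "f differentiable (at xbar)"
    and "g differentiable (at xbar)"
    and "\<exists>ubar :: real ^ 'm.
           (\<forall>x\<in>C. (grad f xbar + (\<Sum>i\<in>UNIV. ubar $ i *\<^sub>R grad (\<lambda>y. g y $ i) xbar)) \<bullet> (x - xbar)
                    \<ge> (\<Sum>i\<in>UNIV. ubar $ i * e i x xbar)) \<and>
           (\<Sum>i\<in>UNIV. ubar $ i * g xbar $ i) = 0 \<and>
           (\<forall>i. g xbar $ i \<le> 0) \<and>
           (\<forall>i. ubar $ i \<ge> 0)"
  shows "is_arg_min f (\<lambda>x. x \<in> C) xbar"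
proof -
  obtain u :: "real ^ 'm"
    where kkt: "\<And>x. x \<in> C \<Longrightarrow> (\<Sum>i\<in>UNIV. u $ i * e i x xbar)
        \<le> (grad f xbar + (\<Sum>i\<in>UNIV. u $ i *\<^sub>R grad (\<lambda>y. g y $ i) xbar)) \<bullet> (x - xbar)"
      and slack: "(\<Sum>i\<in>UNIV. u $ i * g xbar $ i) = 0"
      and feas: "\<And>i. g xbar $ i \<le> 0" and u: "\<And>i. 0 \<le> u $ i"
    using assms(11) by blast
  have compl: "u $ i * g xbar $ i = 0" for i
  proof -
    \<comment> \<open>With the sign flipped every summand is nonnegative, so a zero sum forces each
      summand to vanish.\<close>
    have "(\<Sum>i\<in>UNIV. - (u $ i * g xbar $ i)) = 0"
      using slack by (simp add: sum_negf)
    then have "\<forall>i\<in>UNIV. - (u $ i * g xbar $ i) = 0"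
      by (subst (asm) sum_nonneg_eq_0_iff) (auto intro: mult_nonneg_nonpos feas u)
    then show ?thesis
      by simp
  qed
  have "f xbar \<le> f x" if "x \<in> C" for x
  proof -
    have "x \<in> K"
      using that C_eq by simp
    have "u $ i * (grad (\<lambda>y. g y $ i) xbar \<bullet> (x - xbar)) \<le> u $ i * e i x xbar" for i
    proof (cases "u $ i = 0")
      case False
      \<comment> \<open>A nonzero multiplier makes the constraint active at \<open>xbar\<close>, so
        its value there is 0, while feasibility of \<open>x\<close> gives a value at most 0.\<close>
      then have "g x $ i \<le> g xbar $ i"
        using compl[of i] that C_eq by simp
      moreover have "(\<lambda>y. g y $ i) differentiable (at xbar)"
        using differentiable_compose[OF bounded_linear_imp_differentiable[OF
          bounded_linear_vec_nth] \<open>g differentiable (at xbar)\<close>] .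
      ultimately show ?thesis
        using grad_le_of_e_quasiconvex_on[OF assms(7) \<open>x \<in> K\<close> \<open>xbar \<in> K\<close>] u
        by (intro mult_left_mono) auto
    qed simp
    then have "(\<Sum>i\<in>UNIV. u $ i * (grad (\<lambda>y. g y $ i) xbar \<bullet> (x - xbar)))
        \<le> (\<Sum>i\<in>UNIV. u $ i * e i x xbar)"
      by (rule sum_mono)
    \<comment> \<open>Expanding the inner product, the constraint part is at most the error sum on
      the other side of \<open>kkt\<close>, so the part from \<open>f\<close> cannot be
      negative.\<close>
    with kkt[OF that] have "0 \<le> grad f xbar \<bullet> (x - xbar)"
      by (simp add: inner_add_left inner_sum_left)
    then show ?thesis
      using \<open>pseudoconvex_on K f\<close> \<open>x \<in> K\<close> \<open>xbar \<in> K\<close> unfolding pseudoconvex_on_def by blast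
  qed
  moreover have "xbar \<in> C"
    using feas \<open>xbar \<in> K\<close> C_eq by simp
  ultimately show ?thesis
    unfolding is_arg_min_linorder by blast
qed

end
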